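(* (1) SL does not have the decision-tree model property; (2) SL is not invariant under decision-unwinding. That is, there exist an SL sentence $\varphi$ and a CGS $\mathcal{G}$ with decision-unwinding $\mathcal{G}_{DU}$ such that it is not the case that ($\mathcal{G}\models\varphi$ iff $\mathcal{G}_{DU}\models\varphi$).
   Context: A concurrent game structure (CGS) is a tuple $\mathcal{G}=(\mathrm{AP},\mathrm{Ag},\mathrm{Ac},\mathrm{St},\lambda,\tau,s_0)$ with $\mathrm{AP},\mathrm{Ag}$ finite non-empty, $\mathrm{Ac},\mathrm{St}$ countable non-empty, $s_0\in\mathrm{St}$, $\lambda:\mathrm{St}\to2^{\mathrm{AP}}$, $\tau:\mathrm{St}\times\mathrm{Dc}\to\mathrm{St}$, $\mathrm{Dc}=\mathrm{Ac}^{\mathrm{Ag}}$. Tracks are non-empty finite state sequences following $\tau$; strategies are partial maps from tracks to actions ($s$-total if defined exactly on tracks starting at $s$); assignments are partial maps from $\mathrm{Var}\cup\mathrm{Ag}$ to strategies. For a complete $s$-total assignment $\chi$, the play from $s$ is $\pi_0=s$, $\pi_{i+1}=\tau(\pi_i,d_i)$ with $d_i(a)=\chi(a)(\pi_0\cdots\pi_i)$, and $(\chi,s)^i=(\chi_{\pi_0\cdots\pi_i},\pi_i)$ where each strategy $f$ is translated by $f_\rho(\mathrm{last}(\rho)\cdot\rho')=f(\rho\cdot\rho')$. Strategy Logic (SL) formulas: $\varphi::=p\mid\neg\varphi\mid\varphi\wedge\varphi\mid\varphi\vee\varphi\mid X\varphi\mid\varphi U\varphi\mid\varphi R\varphi\mid\langle\langle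 x\rangle\rangle\varphi\mid[[x]]\varphi\mid(a,x)\varphi$. Semantics: $\langle\langle x\rangle\rangle\varphi$ (resp. $[[x]]\varphi$) holds at $s$ under $\chi$ iff for some (resp. every) $s$-total strategy $f$, $\varphi$ holds under $\chi[x\mapsto f]$; $(a,x)\varphi$ holds iff $\varphi$ holds under $\chi[a\mapsto\chi(x)]$; with complete $\chi$, $X,U,R$ are evaluated as in LTL along $(\chi,s)^0,(\chi,s)^1,\ldots$. A sentence has no free agents or free variables; $\mathcal{G}\models\varphi$ iff $\varphi$ holds at $s_0$ under the empty assignment. A decision tree (DT) is a CGS $(\mathrm{AP},\mathrm{Ag},\mathrm{Ac},\mathrm{Dc}^*,\lambda,\tau,\varepsilon)$ with $\tau(t,d)=t\cdot d$. The decision-unwinding of $\mathcal{G}$ is the DT $\mathcal{G}_{DU}=(\mathrm{AP},\mathrm{Ag},\mathrm{Ac}_{\mathcal{G}},\mathrm{Dc}_{\mathcal{G}}^*,\lambda,\tau,\varepsilon)$ for which there is a surjective $\mathrm{unw}:\mathrm{Dc}_{\mathcal{G}}^*\to\mathrm{St}_{\mathcal{G}}$ with $\mathrm{unw}(\varepsilon)=s_0$, $\mathrm{unw}(\tau(t,d))=\tau_{\mathcal{G}}(\mathrm{unw}(t),d)$, $\lambda(t)=\lambda_{\mathcal{G}}(\mathrm{unw}(t))$. A sentence $\varphi$ has the decision-tree model property if for each CGS $\mathcal{G}$, $\mathcal{G}\models\varphi$ iff $\mathcal{G}_{DU}\models\varphi$; a logic has this property (is invariant under decision-unwinding) if all its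 sentences do. *)

theory Defs
  imports "HOL-Library.FuncSet" "HOL-Library.Countable_Set"
begin

record ('p, 'a, 'c, 's) cgs =
  APs :: "'p set"
  Ags :: "'a set"
  Acs :: "'c set"
  Sts :: "'s set"
  lab :: "'s \<Rightarrow> 'p set"
  trans :: "'s \<Rightarrow> ('a \<Rightarrow> 'c) \<Rightarrow> 's"
  init :: "'s"

(* Decisions are extensional functions (undefined off the agents), so that Dc is in
   bijection with the set of functions from Ag to Ac even if Ag is not the whole type. *)
definition Dc :: "('p, 'a, 'c, 's, 'z) cgs_scheme \<Rightarrow> ('a \<Rightarrow> 'c) set" where
  "Dc G = (Ags G \<rightarrow>\<^sub>E Acs G)"

definition is_cgs :: "('p, 'a, 'c, 's) cgs \<Rightarrow> bool" where
  "is_cgs G \<longleftrightarrow>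
     finite (APs G) \<and> APs G \<noteq> {} \<and> finite (Ags G) \<and> Ags G \<noteq> {} \<and>
     countable (Acs G) \<and> Acs G \<noteq> {} \<and> countable (Sts G) \<and> Sts G \<noteq> {} \<and>
     init G \<in> Sts G \<and>
     (\<forall>s\<in>Sts G. lab G s \<subseteq> APs G) \<and>
     (\<forall>s\<in>Sts G. \<forall>d\<in>Dc G. trans G s d \<in> Sts G)"

definition Trk :: "('p, 'a, 'c, 's) cgs \<Rightarrow> 's list set" where
  "Trk G = {\<rho>. \<rho> \<noteq> [] \<and> set \<rho> \<subseteq> Sts G \<and>
     (\<forall>i. Suc i < length \<rho> \<longrightarrow> (\<exists>d\<in>Dc G. \<rho> ! Suc i = trans G (\<rho> ! i) d))}"

definition Trk_from :: "('p, 'a, 'c, 's) cgs \<Rightarrow> 's \<Rightarrow> 's list set" where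
  "Trk_from G s = {\<rho> \<in> Trk G. hd \<rho> = s}"

type_synonym ('c, 's) strategy = "'s list \<rightharpoonup> 'c"

definition total_strategy :: "('p, 'a, 'c, 's) cgs \<Rightarrow> 's \<Rightarrow> ('c, 's) strategy \<Rightarrow> bool" where
  "total_strategy G s f \<longleftrightarrow> dom f = Trk_from G s \<and> ran f \<subseteq> Acs G"

(* Inl: variables, Inr: agents *)
type_synonym ('v, 'a, 'c, 's) assignment = "('v + 'a) \<rightharpoonup> ('c, 's) strategy"

definition translate :: "'s list \<Rightarrow> ('c, 's) strategy \<Rightarrow> ('c, 's) strategy" where
  "translate \<rho> f = (\<lambda>\<sigma>. if \<sigma> \<noteq> [] \<and> hd \<sigma> = last \<rho> then f (\<rho> @ tl \<sigma>) else None)"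

definition translate_asg ::
  "'s list \<Rightarrow> ('v, 'a, 'c, 's) assignment \<Rightarrow> ('v, 'a, 'c, 's) assignment" where
  "translate_asg \<rho> \<chi> = (\<lambda>l. map_option (translate \<rho>) (\<chi> l))"

(* play_prefix G chi s i is the prefix pi_0 ... pi_i of the play from s. It is meaningful
   when chi is s-total and complete (defined on all agents). *)
primrec play_prefix ::
  "('p, 'a, 'c, 's) cgs \<Rightarrow> ('v, 'a, 'c, 's) assignment \<Rightarrow> 's \<Rightarrow> nat \<Rightarrow> 's list" where
  "play_prefix G \<chi> s 0 = [s]"
| "play_prefix G \<chi> s (Suc i) =
     play_prefix G \<chi> s i @
       [trans G (last (play_prefix G \<chi> s i))
          (\<lambda>a\<in>Ags G. the (the (\<chi> (Inr a)) (play_prefix G \<chi> s i)))]"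

definition play ::
  "('p, 'a, 'c, 's) cgs \<Rightarrow> ('v, 'a, 'c, 's) assignment \<Rightarrow> 's \<Rightarrow> nat \<Rightarrow> 's" where
  "play G \<chi> s i = last (play_prefix G \<chi> s i)"

definition asg_at :: "('p, 'a, 'c, 's) cgs \<Rightarrow> ('v, 'a, 'c, 's) assignment \<Rightarrow> 's \<Rightarrow> nat \<Rightarrow>
    ('v, 'a, 'c, 's) assignment" where
  "asg_at G \<chi> s i = translate_asg (play_prefix G \<chi> s i) \<chi>"

datatype ('p, 'a, 'v) sl =
    Atom 'p
  | Neg "('p, 'a, 'v) sl"
  | Conj "('p, 'a, 'v) sl" "('p, 'a, 'v) sl"
  | Disj "('p, 'a, 'v) sl" "('p, 'a, 'v) sl"
  | Next "('p, 'a, 'v) sl"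
  | Until "('p, 'a, 'v) sl" "('p, 'a, 'v) sl"
  | Release "('p, 'a, 'v) sl" "('p, 'a, 'v) sl"
  | ExStr 'v "('p, 'a, 'v) sl"
  | AllStr 'v "('p, 'a, 'v) sl"
  | Bind 'a 'v "('p, 'a, 'v) sl"

primrec sl_over :: "'p set \<Rightarrow> 'a set \<Rightarrow> ('p, 'a, 'v) sl \<Rightarrow> bool" where
  "sl_over AP Ag (Atom p) \<longleftrightarrow> p \<in> AP"
| "sl_over AP Ag (Neg \<phi>) \<longleftrightarrow> sl_over AP Ag \<phi>"
| "sl_over AP Ag (Conj \<phi> \<psi>) \<longleftrightarrow> sl_over AP Ag \<phi> \<and> sl_over AP Ag \<psi>"
| "sl_over AP Ag (Disj \<phi> \<psi>) \<longleftrightarrow> sl_over AP Ag \<phi> \<and> sl_over AP Ag \<psi>"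
| "sl_over AP Ag (Next \<phi>) \<longleftrightarrow> sl_over AP Ag \<phi>"
| "sl_over AP Ag (Until \<phi> \<psi>) \<longleftrightarrow> sl_over AP Ag \<phi> \<and> sl_over AP Ag \<psi>"
| "sl_over AP Ag (Release \<phi> \<psi>) \<longleftrightarrow> sl_over AP Ag \<phi> \<and> sl_over AP Ag \<psi>"
| "sl_over AP Ag (ExStr x \<phi>) \<longleftrightarrow> sl_over AP Ag \<phi>"
| "sl_over AP Ag (AllStr x \<phi>) \<longleftrightarrow> sl_over AP Ag \<phi>"
| "sl_over AP Ag (Bind a x \<phi>) \<longleftrightarrow> a \<in> Ag \<and> sl_over AP Ag \<phi>"

(* A temporal operator makes all agents free, since its evaluation needs a play; binding an
   agent that is not free does not make the variable free. *)
primrec free :: "'a set \<Rightarrow> ('p, 'a, 'v) sl \<Rightarrow> ('v + 'a) set" where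
  "free Ag (Atom p) = {}"
| "free Ag (Neg \<phi>) = free Ag \<phi>"
| "free Ag (Conj \<phi> \<psi>) = free Ag \<phi> \<union> free Ag \<psi>"
| "free Ag (Disj \<phi> \<psi>) = free Ag \<phi> \<union> free Ag \<psi>"
| "free Ag (Next \<phi>) = Inr ` Ag \<union> free Ag \<phi>"
| "free Ag (Until \<phi> \<psi>) = Inr ` Ag \<union> free Ag \<phi> \<union> free Ag \<psi>"
| "free Ag (Release \<phi> \<psi>) = Inr ` Ag \<union> free Ag \<phi> \<union> free Ag \<psi>"
| "free Ag (ExStr x \<phi>) = free Ag \<phi> - {Inl x}"
| "free Ag (AllStr x \<phi>) = free Ag \<phi> - {Inl x}"
| "free Ag (Bind a x \<phi>) =
     (if Inr a \<in> free Ag \<phi> then (free Ag \<phi> - {Inr a}) \<union> {Inl x} else free Ag \<phi>)"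

definition sl_sentence :: "'p set \<Rightarrow> 'a set \<Rightarrow> ('p, 'a, 'v) sl \<Rightarrow> bool" where
  "sl_sentence AP Ag \<phi> \<longleftrightarrow> sl_over AP Ag \<phi> \<and> free Ag \<phi> = {}"

(* Meaningful for s-total chi defined on the free agents and variables of the formula; then
   chi is complete whenever a temporal operator is evaluated. *)
primrec sat :: "('p, 'a, 'c, 's) cgs \<Rightarrow> ('v, 'a, 'c, 's) assignment \<Rightarrow> 's \<Rightarrow>
    ('p, 'a, 'v) sl \<Rightarrow> bool" where
  "sat G \<chi> s (Atom p) \<longleftrightarrow> p \<in> lab G s"
| "sat G \<chi> s (Neg \<phi>) \<longleftrightarrow> \<not> sat G \<chi> s \<phi>"
| "sat G \<chi> s (Conj \<phi> \<psi>) \<longleftrightarrow> sat G \<chi> s \<phi> \<and> sat G \<chi> s \<psi>"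
| "sat G \<chi> s (Disj \<phi> \<psi>) \<longleftrightarrow> sat G \<chi> s \<phi> \<or> sat G \<chi> s \<psi>"
| "sat G \<chi> s (Next \<phi>) \<longleftrightarrow> sat G (asg_at G \<chi> s 1) (play G \<chi> s 1) \<phi>"
| "sat G \<chi> s (Until \<phi> \<psi>) \<longleftrightarrow>
     (\<exists>i. sat G (asg_at G \<chi> s i) (play G \<chi> s i) \<psi> \<and>
          (\<forall>j<i. sat G (asg_at G \<chi> s j) (play G \<chi> s j) \<phi>))"
| "sat G \<chi> s (Release \<phi> \<psi>) \<longleftrightarrow>
     (\<forall>i. sat G (asg_at G \<chi> s i) (play G \<chi> s i) \<psi> \<or>
          (\<exists>j<i. sat G (asg_at G \<chi> s j) (play G \<chi> s j) \<phi>))"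
| "sat G \<chi> s (ExStr x \<phi>) \<longleftrightarrow> (\<exists>f. total_strategy G s f \<and> sat G (\<chi>(Inl x \<mapsto> f)) s \<phi>)"
| "sat G \<chi> s (AllStr x \<phi>) \<longleftrightarrow> (\<forall>f. total_strategy G s f \<longrightarrow> sat G (\<chi>(Inl x \<mapsto> f)) s \<phi>)"
| "sat G \<chi> s (Bind a x \<phi>) \<longleftrightarrow> sat G (\<chi>(Inr a := \<chi> (Inl x))) s \<phi>"

definition models :: "('p, 'a, 'c, 's) cgs \<Rightarrow> ('p, 'a, 'v) sl \<Rightarrow> bool" where
  "models G \<phi> \<longleftrightarrow> sat G Map.empty (init G) \<phi>"

definition is_dt :: "('p, 'a, 'c, ('a \<Rightarrow> 'c) list) cgs \<Rightarrow> bool" where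
  "is_dt D \<longleftrightarrow> is_cgs D \<and> Sts D = lists (Dc D) \<and> init D = [] \<and>
     (\<forall>t\<in>lists (Dc D). \<forall>d\<in>Dc D. trans D t d = t @ [d])"

(* Surjectivity of unw restricts this to structures all of whose states are reachable. On
   its carrier, the unwinding is determined uniquely by G. *)
definition is_decision_unwinding ::
  "('p, 'a, 'c, 's) cgs \<Rightarrow> ('p, 'a, 'c, ('a \<Rightarrow> 'c) list) cgs \<Rightarrow> bool" where
  "is_decision_unwinding G D \<longleftrightarrow>
     is_dt D \<and> APs D = APs G \<and> Ags D = Ags G \<and> Acs D = Acs G \<and>
     (\<exists>unw. unw ` Sts D = Sts G \<and> unw [] = init G \<and>
        (\<forall>t\<in>Sts D. \<forall>d\<in>Dc D. unw (trans D t d) = trans G (unw t) d) \<and>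
        (\<forall>t\<in>Sts D. lab D t = lab G (unw t)))"

(* All carriers below are subsets of nat: no generality is lost, as AP and Ag are finite and
   Ac and St countable. Var is nat. *)
type_synonym nat_cgs = "(nat, nat, nat, nat) cgs"
type_synonym nat_dt = "(nat, nat, nat, (nat \<Rightarrow> nat) list) cgs"
type_synonym nat_sl = "(nat, nat, nat) sl"

definition decision_tree_model_property :: "nat set \<Rightarrow> nat set \<Rightarrow> nat_sl \<Rightarrow> bool" where
  "decision_tree_model_property AP Ag \<phi> \<longleftrightarrow>
     (\<forall>(G :: nat_cgs) (D :: nat_dt).
        is_cgs G \<and> APs G = AP \<and> Ags G = Ag \<and> is_decision_unwinding G D \<longrightarrow>
        (models G \<phi> \<longleftrightarrow> models D \<phi>))"

definition SL_has_decision_tree_model_property :: bool where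
  "SL_has_decision_tree_model_property \<longleftrightarrow>
     (\<forall>AP Ag \<phi>. finite AP \<and> AP \<noteq> {} \<and> finite Ag \<and> Ag \<noteq> {} \<and> sl_sentence AP Ag \<phi> \<longrightarrow>
        decision_tree_model_property AP Ag \<phi>)"

(* Invariance of a logic under decision-unwinding is, by definition, another name for the
   decision-tree model property of the logic. *)
definition SL_invariant_under_decision_unwinding :: bool where
  "SL_invariant_under_decision_unwinding \<longleftrightarrow> SL_has_decision_tree_model_property"

end

(* Merge all first decisions into one state and let agent 1 alone choose the second move. A
   strategy of agent 1 in the game sees only states, so its second move cannot depend on the
   first action of agent 0; in the decision-unwinding the track records that action. The
   sentence says that one strategy of agent 1 admits two strategies of agent 0 leading to
   different truth values of the atom after two steps. *)
theory Submission
  imports Defs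
begin

text \<open>State 1 absorbs every first decision, so \<open>[0, 1]\<close> is the only two-state
  track from the start; 2 and 3 are sinks recording the second action of agent 1.\<close>

definition merge_game :: nat_cgs where
  "merge_game = \<lparr>APs = {0}, Ags = {0, 1}, Acs = {0, 1}, Sts = {0, 1, 2, 3},
     lab = (\<lambda>s. if s = 2 then {0} else {}),
     trans = (\<lambda>s d. if s = 0 then 1 else if s = 1 then (if d 1 = 0 then 2 else 3) else s),
     init = 0\<rparr>"

text \<open>On words of decisions the unwinding equations force this map: it runs the game from its
  initial state.\<close>

definition merge_unw :: "(nat \<Rightarrow> nat) list \<Rightarrow> nat" where
  "merge_unw t = foldl (trans merge_game) 0 t"

definition merge_tree :: nat_dt where
  "merge_tree = \<lparr>APs = {0}, Ags = {0, 1}, Acs = {0, 1}, Sts = lists ({0, 1} \<rightarrow>\<^sub>E {0, 1}),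
     lab = (\<lambda>t. lab merge_game (merge_unw t)), trans = (\<lambda>t d. t @ [d]), init = []\<rparr>"

text \<open>Agent 1 is bound outside the conjunction, so both conjuncts share its strategy; only
  agent 0 is rebound between them.\<close>

definition dependence_sentence :: nat_sl where
  "dependence_sentence = ExStr 0 (ExStr 1 (ExStr 2 (Bind 1 0 (Conj
     (Bind 0 1 (Next (Next (Atom 0))))
     (Bind 0 2 (Next (Next (Neg (Atom 0)))))))))"

lemma init_merge_game: "init merge_game = 0"
  by (simp add: merge_game_def)

lemma is_cgs_merge_game: "is_cgs merge_game"
  by (auto simp: is_cgs_def merge_game_def)

lemma sl_sentence_dependence: "sl_sentence {0} {0, 1} dependence_sentence"
  by (auto simp: sl_sentence_def dependence_sentence_def)

lemma Dc_merge_tree: "Dc merge_tree = ({0, 1} \<rightarrow>\<^sub>E {0, 1})"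
  by (simp add: Dc_def merge_tree_def)

lemma Dc_merge_game: "Dc merge_game = ({0, 1} \<rightarrow>\<^sub>E {0, 1})"
  by (simp add: Dc_def merge_game_def)

lemma merge_unw_closed: "t \<in> lists (Dc merge_game) \<Longrightarrow> merge_unw t \<in> Sts merge_game"
proof (induction t rule: rev_induct)
  case Nil
  show ?case by (simp add: merge_unw_def merge_game_def)
next
  case (snoc d t)
  then show ?case
    using is_cgs_merge_game by (auto simp: merge_unw_def is_cgs_def)
qed

lemma merge_tree_simps: "Ags merge_tree = {0, 1}" "trans merge_tree t d = t @ [d]"
    "APs merge_tree = {0}" "Acs merge_tree = {0, 1}" "init merge_tree = []"
    "Sts merge_tree = lists (Dc merge_game)" "lab merge_tree t = lab merge_game (merge_unw t)"
  by (simp_all add: merge_tree_def Dc_merge_game)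

lemma is_dt_merge_tree: "is_dt merge_tree"
proof -
  have Dc: "Dc merge_tree = Dc merge_game"
    by (simp add: Dc_merge_tree Dc_merge_game)
  have "countable (lists (Dc merge_game))"
    unfolding Dc_merge_game by (intro countable_lists countable_finite finite_PiE) auto
  moreover have "lab merge_game s \<subseteq> {0}" for s
    by (simp add: merge_game_def)
  ultimately have "is_cgs merge_tree"
    unfolding is_cgs_def Dc merge_tree_simps by auto
  then show ?thesis
    by (simp add: is_dt_def Dc merge_tree_simps)
qed

lemma surj_merge_unw: "merge_unw ` Sts merge_tree = Sts merge_game"
proof
  show "merge_unw ` Sts merge_tree \<subseteq> Sts merge_game"
    using merge_unw_closed by (auto simp: merge_tree_def Dc_merge_game)
  \<comment> \<open>In \<open>c k\<close> both agents play \<open>k\<close>. Two such decisions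
    suffice to reach every state, since only the second action of agent 1 matters.\<close>
  define c :: "nat \<Rightarrow> nat \<Rightarrow> nat" where "c k = (\<lambda>a\<in>{0, 1}. k)" for k
  have st: "[] \<in> Sts merge_tree" "[c 0] \<in> Sts merge_tree"
    "[c 0, c 0] \<in> Sts merge_tree" "[c 0, c 1] \<in> Sts merge_tree"
    by (auto simp: merge_tree_def c_def)
  have "merge_unw [] = 0" "merge_unw [c 0] = 1" "merge_unw [c 0, c 0] = 2"
    "merge_unw [c 0, c 1] = 3"
    by (auto simp: merge_unw_def merge_game_def c_def)
  with st have "{0, 1, 2, 3} \<subseteq> merge_unw ` Sts merge_tree"
    by (metis empty_subsetI imageI insert_subset)
  then show "Sts merge_game \<subseteq> merge_unw ` Sts merge_tree"
    by (simp add: merge_game_def)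
qed

lemma is_decision_unwinding_merge: "is_decision_unwinding merge_game merge_tree"
  unfolding is_decision_unwinding_def
proof (intro conjI exI[of _ merge_unw])
  show "is_dt merge_tree" by (rule is_dt_merge_tree)
  show "merge_unw ` Sts merge_tree = Sts merge_game" by (rule surj_merge_unw)
qed (simp_all add: merge_tree_def merge_game_def merge_unw_def)

text \<open>The history after one step is \<open>[0, 1]\<close> whatever agent 0 does, so only the
  value of \<open>x\<close> there counts. The nested \<open>play\<close> is what two nested
  \<open>Next\<close> unfold to.\<close>

lemma second_state_merge_game:
  assumes "\<chi> (Inr 1) = Some x"
  shows "play merge_game (asg_at merge_game \<chi> 0 1) (play merge_game \<chi> 0 1) 1
    = (if the (x [0, 1]) = 0 then 2 else 3)"
proof -
  have prefix: "play_prefix merge_game \<chi> 0 1 = [0, 1]"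
    by (simp add: merge_game_def)
  \<comment> \<open>The play restarts from state 1 with history \<open>[1]\<close>, on which the
    translated strategy takes the value of \<open>x\<close> at \<open>[0, 1]\<close>.\<close>
  have "asg_at merge_game \<chi> 0 1 (Inr 1) = Some (translate [0, 1] x)"
    unfolding asg_at_def prefix using assms by (simp add: translate_asg_def)
  then show ?thesis
    unfolding play_def prefix by (simp add: merge_game_def translate_def)
qed

lemma not_models_merge_game: "\<not> models merge_game dependence_sentence"
proof
  assume "models merge_game dependence_sentence"
  then obtain x y z where
    "sat merge_game ([Inl 0 \<mapsto> x, Inl 1 \<mapsto> y, Inl 2 \<mapsto> z, Inr 1 \<mapsto> x, Inr 0 \<mapsto> y]
       :: (nat, nat, nat, nat) assignment) 0 (Next (Next (Atom 0)))"
    "sat merge_game ([Inl 0 \<mapsto> x, Inl 1 \<mapsto> y, Inl 2 \<mapsto> z, Inr 1 \<mapsto> x, Inr 0 \<mapsto> z]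
       :: (nat, nat, nat, nat) assignment) 0 (Next (Next (Neg (Atom 0))))"
    unfolding models_def dependence_sentence_def init_merge_game
    by (auto simp del: sat.simps(5))
  \<comment> \<open>Agent 1 follows \<open>x\<close> under both assignments, so replacing
    \<open>y\<close> by \<open>z\<close> leaves the state reached unchanged.\<close>
  then have "0 \<in> lab merge_game (if the (x [0, 1]) = 0 then 2 else 3)"
    "0 \<notin> lab merge_game (if the (x [0, 1]) = 0 then 2 else 3)"
    by (simp_all add: second_state_merge_game[where x = x] del: One_nat_def)
  then show False by blast
qed

lemma sat_ExStrI:
  assumes "total_strategy G s f" and "sat G (\<chi>(Inl x \<mapsto> f)) s \<phi>"
  shows "sat G \<chi> s (ExStr x \<phi>)"
  using assms by auto

text \<open>Agent 1 repeats as its second move the first action of agent 0, which the tree state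
  still records; the two constant strategies of agent 0 then lead to opposite outcomes.\<close>

lemma models_merge_tree: "models merge_tree dependence_sentence"
proof -
  let ?T = "Trk_from merge_tree []"
  \<comment> \<open>\<open>last \<rho>\<close> is a word of decisions, and its head at 0 is the
    first action of agent 0. At the root the word is empty and the default is 0.\<close>
  define copycat :: "(nat, (nat \<Rightarrow> nat) list) strategy" where
    "copycat = (\<lambda>\<rho>. if \<rho> \<in> ?T
       then Some (if last \<rho> \<noteq> [] \<and> hd (last \<rho>) 0 = 1 then 1 else 0) else None)"
  define const :: "nat \<Rightarrow> (nat, (nat \<Rightarrow> nat) list) strategy" where
    "const k = (\<lambda>\<rho>. if \<rho> \<in> ?T then Some k else None)" for k
  have total: "total_strategy merge_tree [] copycat"
    "total_strategy merge_tree [] (const 0)" "total_strategy merge_tree [] (const 1)"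
    by (auto simp: total_strategy_def copycat_def const_def ran_def dom_def merge_tree_def
        split: if_splits)
  \<comment> \<open>The strategies have values only on tracks, so the histories consulted in the
    first two moves must be shown to be tracks.\<close>
  have root: "[[]] \<in> ?T"
    by (simp add: Trk_from_def Trk_def merge_tree_def)
  have child: "[[], [d]] \<in> ?T" if "d \<in> {0, 1} \<rightarrow>\<^sub>E {0, 1}" for d
  proof -
    have "set [[], [d]] \<subseteq> Sts merge_tree"
      using that by (simp add: merge_tree_def)
    moreover have "\<exists>e\<in>Dc merge_tree. [[], [d]] ! Suc i = trans merge_tree ([[], [d]] ! i) e"
      if "Suc i < length [[], [d]]" for i
      using that \<open>d \<in> _\<close> by (intro bexI[of _ d]) (simp_all add: merge_tree_simps Dc_merge_tree)
    ultimately show ?thesis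
      by (simp add: Trk_from_def Trk_def)
  qed
  \<comment> \<open>\<open>\<chi> 0\<close> and \<open>\<chi> 1\<close> are the assignments produced
    by the two inner bindings of agent 0.\<close>
  define \<chi> :: "nat \<Rightarrow> (nat, nat, nat, (nat \<Rightarrow> nat) list) assignment" where
    "\<chi> k = [Inl 0 \<mapsto> copycat, Inl 1 \<mapsto> const 0, Inl 2 \<mapsto> const 1,
       Inr 1 \<mapsto> copycat, Inr 0 \<mapsto> const k]" for k
  \<comment> \<open>The first decision under \<open>\<chi> k\<close>: agent 0 plays
    \<open>k\<close>, agent 1 the default 0 of \<open>copycat\<close>.\<close>
  define d :: "nat \<Rightarrow> nat \<Rightarrow> nat" where "d k = (\<lambda>a\<in>{0, 1}. if a = 0 then k else 0)" for k
  have prefix: "play_prefix merge_tree (\<chi> k) [] 1 = [[], [d k]]" for k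
  proof -
    have "copycat [[]] = Some 0" "const k [[]] = Some k"
      using root by (simp_all add: copycat_def const_def)
    then show ?thesis
      by (auto simp: merge_tree_simps \<chi>_def d_def)
  qed
  \<comment> \<open>In the second decision agent 0 plays \<open>k\<close> again and agent 1 copies
    it; the copy is exact because \<open>k\<close> is 0 or 1.\<close>
  have second: "play merge_tree (asg_at merge_tree (\<chi> k) [] 1) (play merge_tree (\<chi> k) [] 1) 1
      = [d k, \<lambda>a\<in>{0, 1}. k]" if "k \<in> {0, 1}" for k
  proof -
    have "d k \<in> {0, 1} \<rightarrow>\<^sub>E {0, 1}"
      using that by (auto simp: d_def)
    then have "[[], [d k]] \<in> ?T" by (rule child)
    then have "copycat [[], [d k]] = Some k" "const k [[], [d k]] = Some k"
      using that by (auto simp: copycat_def const_def d_def)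
    moreover have "asg_at merge_tree (\<chi> k) [] 1 (Inr 1) = Some (translate [[], [d k]] copycat)"
      "asg_at merge_tree (\<chi> k) [] 1 (Inr 0) = Some (translate [[], [d k]] (const k))"
      unfolding asg_at_def prefix by (simp_all add: translate_asg_def \<chi>_def)
    ultimately show ?thesis
      unfolding play_def prefix
      by (auto simp: merge_tree_simps translate_def restrict_def fun_eq_iff)
  qed
  \<comment> \<open>The two words of decisions unwind to state 2 for \<open>k = 0\<close> and to
    state 3 for \<open>k = 1\<close>, and the atom holds only at 2.\<close>
  have "sat merge_tree (\<chi> 0) [] (Next (Next (Atom 0)))"
    "sat merge_tree (\<chi> 1) [] (Next (Next (Neg (Atom 0))))"
    unfolding sat.simps second[of 0, OF insertI1] second[of 1, OF insertI2, OF insertI1]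
      merge_tree_simps
    by (simp_all add: merge_unw_def merge_game_def)
  then have "sat merge_tree ([Inl 0 \<mapsto> copycat, Inl 1 \<mapsto> const 0, Inl 2 \<mapsto> const 1]
     :: (nat, nat, nat, (nat \<Rightarrow> nat) list) assignment) []
     (Bind 1 0 (Conj (Bind 0 1 (Next (Next (Atom 0)))) (Bind 0 2 (Next (Next (Neg (Atom 0)))))))"
    by (simp add: \<chi>_def del: sat.simps(5))
  then have "sat merge_tree Map.empty [] dependence_sentence"
    unfolding dependence_sentence_def
    by (rule sat_ExStrI[OF total(1) sat_ExStrI[OF total(2) sat_ExStrI[OF total(3)]]])
  then show ?thesis
    by (simp add: models_def merge_tree_def)
qed

theorem mainTheorem6:
  shows "\<not> SL_has_decision_tree_model_property \<and>
         \<not> SL_invariant_under_decision_unwinding \<and>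
         (\<exists>(\<phi> :: nat_sl) (G :: nat_cgs) (D :: nat_dt).
            is_cgs G \<and> sl_sentence (APs G) (Ags G) \<phi> \<and> is_decision_unwinding G D \<and>
            \<not> (models G \<phi> \<longleftrightarrow> models D \<phi>))"
proof -
  have carriers: "APs merge_game = {0}" "Ags merge_game = {0, 1}"
    by (simp_all add: merge_game_def)
  have differ: "\<not> (models merge_game dependence_sentence \<longleftrightarrow> models merge_tree dependence_sentence)"
    using not_models_merge_game models_merge_tree by simp
  have "\<not> decision_tree_model_property {0} {0, 1} dependence_sentence"
    unfolding decision_tree_model_property_def
    using is_cgs_merge_game carriers is_decision_unwinding_merge differ by blast
  then have "\<not> SL_has_decision_tree_model_property"
    using sl_sentence_dependence
    by (metis SL_has_decision_tree_model_property_def finite.emptyI finite.insertI insert_not_empty)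
  moreover have "sl_sentence (APs merge_game) (Ags merge_game) dependence_sentence"
    using sl_sentence_dependence carriers by simp
  \<comment> \<open>Invariance is the model property by definition, so its failure is the first
    conjunct again.\<close>
  ultimately show ?thesis
    using is_cgs_merge_game is_decision_unwinding_merge differ
    by (metis SL_invariant_under_decision_unwinding_def)
qed

end
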